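(* Let $\mathcal{H}$ be a real Hilbert space and let $V:\mathcal{H}\to\mathcal{H}$ be monotone and continuous. Let $\alpha>2$, $s_0>0$, $t_0\ge0$. Consider the second-order systems $$\text{(HB)}\quad\begin{cases}\ddot y(t)+\frac{2(\alpha-1)}{\alpha}\dot y(t)+\frac{2s_0}{\alpha}\exp\left(\frac{2(t-t_0)}{\alpha}\right)\frac{d}{dt}V(y(t))+\frac{2s_0}{\alpha}\exp\left(\frac{2(t-t_0)}{\alpha}\right)V(y(t))=0\quad(t\ge t_0),\\ y(t_0)=y_0,\quad\dot y(t_0)=y_1,\end{cases}$$ and $$\text{(AVD)}\quad\begin{cases}\ddot x(s)+\frac{\alpha}{s}\dot x(s)+\frac{d}{ds}V(x(s))+\frac{\alpha}{2s}V(x(s))=0\quad(s\ge s_0),\\ x(s_0)=x_0,\quad\dot x(s_0)=x_1,\end{cases}$$ with $y_0,y_1,x_0,x_1\in\mathcal{H}$. Then the following statements are true. (i) If $y:[t_0,+\infty)\to\mathcal{H}$ is a solution of (HB) and $\tau:[s_0,+\infty)\to[t_0,+\infty)$ is given by $\tau(s):=\frac{\alpha}{2}\ln\left(\frac{s}{s_0}\right)+t_0$, then $x:[s_0,+\infty)\to\mathcal{H}$, $x(s):=y(\tau(s))$, is a solution of (AVD) for the initial conditions $$x(s_0)=y_0\quad\text{and}\quad\dot x(s_0)=\frac{\alpha}{2s_0}y_1 .$$ (ii) If $x:[s_0,+\infty)\to\mathcal{H}$ is a solution of (AVD) and $\sigma:[t_0,+\infty)\to[s_0,+\infty)$ is given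 by $\sigma(t):=s_0\exp\left(\frac{2(t-t_0)}{\alpha}\right)$, then $y:[t_0,+\infty)\to\mathcal{H}$, $y(t):=x(\sigma(t))$, is a solution of (HB) for the initial conditions $$y(t_0)=x_0\quad\text{and}\quad\dot y(t_0)=\frac{2s_0}{\alpha}x_1 .$$
   Context: $V$ is monotone if $\langle V(y)-V(x),y-x\rangle\ge0$ for all $x,y\in\mathcal{H}$. A solution of either system is a function $z$ ($z=y$ or $z=x$) on the respective interval $[r_0,+\infty)$ such that $z$, $\dot z$ and $r\mapsto V(z(r))$ are absolutely continuous on each interval $[r_0,r_1]$, the equation holds for almost every $r\ge r_0$, and the stated initial conditions hold. *)

theory Defs
  imports "HOL-Analysis.Analysis"
begin

definition monotone_operator :: "('a::real_inner \<Rightarrow> 'a) \<Rightarrow> bool" where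
  "monotone_operator V \<longleftrightarrow> (\<forall>x y. (V y - V x) \<bullet> (y - x) \<ge> 0)"

(* Absolute continuity of f on [a,b]: the epsilon-delta definition over finite families of
   pairwise non-overlapping subintervals [l i, u i]. *)
definition abs_continuous_on_interval ::
  "real \<Rightarrow> real \<Rightarrow> (real \<Rightarrow> 'a::real_normed_vector) \<Rightarrow> bool" where
  "abs_continuous_on_interval a b f \<longleftrightarrow>
     (\<forall>\<epsilon>>0. \<exists>\<delta>>0. \<forall>(n::nat) (l::nat \<Rightarrow> real) (u::nat \<Rightarrow> real).
        (\<forall>i<n. a \<le> l i \<and> l i \<le> u i \<and> u i \<le> b) \<longrightarrow>
        disjoint_family_on (\<lambda>i. {l i<..<u i}) {..<n} \<longrightarrow>
        (\<Sum>i<n. u i - l i) < \<delta> \<longrightarrow>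
        (\<Sum>i<n. norm (f (u i) - f (l i))) < \<epsilon>)"

(* Functions on [r0, +oo) are represented by total functions on the reals. Derivatives are taken
   within [r0, +oo), so they are one-sided at r0 and do not depend on values to the left of r0. *)
abbreviation diff_from :: "real \<Rightarrow> (real \<Rightarrow> 'a::real_normed_vector) \<Rightarrow> real \<Rightarrow> bool" where
  "diff_from r0 f r \<equiv> f differentiable (at r within {r0..})"

abbreviation deriv_from :: "real \<Rightarrow> (real \<Rightarrow> 'a::real_normed_vector) \<Rightarrow> real \<Rightarrow> 'a" where
  "deriv_from r0 f r \<equiv> vector_derivative f (at r within {r0..})"

(* The first derivative of z has to exist at every point of [r0, +oo): it is required to be
   absolutely continuous and its value at r0 is prescribed. *)
definition solution_regularity ::
  "('a::real_normed_vector \<Rightarrow> 'a) \<Rightarrow> real \<Rightarrow> (real \<Rightarrow> 'a) \<Rightarrow> bool" where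
  "solution_regularity V r0 z \<longleftrightarrow>
     (\<forall>r\<ge>r0. diff_from r0 z r) \<and>
     (\<forall>r1\<ge>r0. abs_continuous_on_interval r0 r1 z \<and>
              abs_continuous_on_interval r0 r1 (deriv_from r0 z) \<and>
              abs_continuous_on_interval r0 r1 (\<lambda>r. V (z r)))"

(* vector_derivative is total, hence the explicit requirement, as part of the equation holding at a
   point, that the derivatives of z' and of V o z exist there. *)
definition HB_solution ::
  "('a::real_normed_vector \<Rightarrow> 'a) \<Rightarrow> real \<Rightarrow> real \<Rightarrow> real \<Rightarrow> 'a \<Rightarrow> 'a \<Rightarrow> (real \<Rightarrow> 'a) \<Rightarrow> bool" where
  "HB_solution V \<alpha> s0 t0 y0 y1 y \<longleftrightarrow>
     solution_regularity V t0 y \<and>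
     (AE t in lebesgue. t \<ge> t0 \<longrightarrow>
        diff_from t0 (deriv_from t0 y) t \<and> diff_from t0 (\<lambda>r. V (y r)) t \<and>
        deriv_from t0 (deriv_from t0 y) t
          + (2 * (\<alpha> - 1) / \<alpha>) *\<^sub>R deriv_from t0 y t
          + (2 * s0 / \<alpha> * exp (2 * (t - t0) / \<alpha>)) *\<^sub>R deriv_from t0 (\<lambda>r. V (y r)) t
          + (2 * s0 / \<alpha> * exp (2 * (t - t0) / \<alpha>)) *\<^sub>R V (y t) = 0) \<and>
     y t0 = y0 \<and> deriv_from t0 y t0 = y1"

definition AVD_solution ::
  "('a::real_normed_vector \<Rightarrow> 'a) \<Rightarrow> real \<Rightarrow> real \<Rightarrow> 'a \<Rightarrow> 'a \<Rightarrow> (real \<Rightarrow> 'a) \<Rightarrow> bool" where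
  "AVD_solution V \<alpha> s0 x0 x1 x \<longleftrightarrow>
     solution_regularity V s0 x \<and>
     (AE s in lebesgue. s \<ge> s0 \<longrightarrow>
        diff_from s0 (deriv_from s0 x) s \<and> diff_from s0 (\<lambda>r. V (x r)) s \<and>
        deriv_from s0 (deriv_from s0 x) s
          + (\<alpha> / s) *\<^sub>R deriv_from s0 x s
          + deriv_from s0 (\<lambda>r. V (x r)) s
          + (\<alpha> / (2 * s)) *\<^sub>R V (x s) = 0) \<and>
     x s0 = x0 \<and> deriv_from s0 x s0 = x1"

end

theory Submission
  imports Defs
begin

text \<open>
  With \<open>\<sigma>(t) = s\<^sub>0 exp (2 (t - t\<^sub>0) / \<alpha>)\<close> the coefficient of \<open>V\<close> in (HB) is \<open>2 \<sigma> / \<alpha> = \<sigma>'\<close>. The smooth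
  increasing bijection \<open>\<sigma>\<close> and its inverse \<open>\<tau>\<close>, which satisfies \<open>\<tau>' = \<alpha> / (2 s)\<close>, preserve absolute
  continuity and null sets, so the chain rule \<open>x'' = \<tau>'\<^sup>2 y''(\<tau>) + \<tau>'' y'(\<tau>)\<close> holds almost
  everywhere and turns the left-hand side of (AVD) into \<open>\<tau>'\<^sup>2\<close> times that of (HB).
\<close>

section \<open>Absolute continuity on compact intervals\<close>

definition short_family ::
  "real \<Rightarrow> real \<Rightarrow> real \<Rightarrow> nat \<Rightarrow> (nat \<Rightarrow> real) \<Rightarrow> (nat \<Rightarrow> real) \<Rightarrow> bool" where
  "short_family a b \<delta> n l u \<longleftrightarrow>
     (\<forall>i<n. a \<le> l i \<and> l i \<le> u i \<and> u i \<le> b) \<and>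
     disjoint_family_on (\<lambda>i. {l i<..<u i}) {..<n} \<and> (\<Sum>i<n. u i - l i) < \<delta>"

text \<open>Bundling the side conditions on a family into one predicate lets the arguments below
  hand a whole family over as a single fact.\<close>

lemma abs_continuous_on_interval_iff:
  "abs_continuous_on_interval a b f \<longleftrightarrow>
     (\<forall>\<epsilon>>0. \<exists>\<delta>>0. \<forall>n l u. short_family a b \<delta> n l u \<longrightarrow> (\<Sum>i<n. norm (f (u i) - f (l i))) < \<epsilon>)"
  unfolding abs_continuous_on_interval_def short_family_def by (simp only: imp_conjL)

lemma abs_continuous_on_intervalI:
  assumes "\<And>\<epsilon>. \<epsilon> > 0 \<Longrightarrow>
    \<exists>\<delta>>0. \<forall>n l u. short_family a b \<delta> n l u \<longrightarrow> (\<Sum>i<n. norm (f (u i) - f (l i))) < \<epsilon>"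
  shows "abs_continuous_on_interval a b f"
  using assms unfolding abs_continuous_on_interval_iff by blast

lemma short_family_bounds:
  assumes "short_family a b \<delta> n l u" "i < n"
  shows "a \<le> l i" "l i \<le> u i" "u i \<le> b"
  using assms by (auto simp: short_family_def)

lemma short_family_mono: "short_family a b \<delta> n l u \<Longrightarrow> \<delta> \<le> \<delta>' \<Longrightarrow> short_family a b \<delta>' n l u"
  by (auto simp: short_family_def)

text \<open>All endpoints of an admissible family lie in [a,b], so values elsewhere never enter.
  This matters because functions on half-lines are total functions here, and a transformed
  trajectory agrees with the composition only on its half-line.\<close>

lemma abs_continuous_on_interval_cong:
  assumes eq: "\<And>r. r \<in> {a..b} \<Longrightarrow> f r = g r"
  shows "abs_continuous_on_interval a b f \<longleftrightarrow> abs_continuous_on_interval a b g"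
proof -
  have "(\<Sum>i<n. norm (f (u i) - f (l i))) = (\<Sum>i<n. norm (g (u i) - g (l i)))"
    if "short_family a b \<delta> n l u" for \<delta> n l u
  proof (rule sum.cong[OF refl])
    fix i assume "i \<in> {..<n}"
    then have "l i \<in> {a..b}" "u i \<in> {a..b}" using short_family_bounds[OF that, of i] by auto
    then show "norm (f (u i) - f (l i)) = norm (g (u i) - g (l i))" by (simp add: eq)
  qed
  then show ?thesis unfolding abs_continuous_on_interval_iff by (simp cong: imp_cong)
qed

text \<open>Families consisting of one subinterval suffice: the interval between two points, with
  endpoints ordered by \<open>min\<close> and \<open>max\<close>.\<close>

lemma abs_continuous_on_interval_imp_continuous_on:
  assumes "abs_continuous_on_interval a b f"
  shows "continuous_on {a..b} f"
  unfolding continuous_on_iff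
proof (intro ballI allI impI)
  fix x \<epsilon> :: real assume x: "x \<in> {a..b}" and "\<epsilon> > 0"
  then obtain \<delta> where \<delta>: "\<delta> > 0"
    "\<And>n l u. short_family a b \<delta> n l u \<Longrightarrow> (\<Sum>i<n. norm (f (u i) - f (l i))) < \<epsilon>"
    using assms unfolding abs_continuous_on_interval_iff by blast
  have "dist (f x') (f x) < \<epsilon>" if x': "x' \<in> {a..b}" and d: "dist x' x < \<delta>" for x'
  proof -
    have "norm (f (max x x') - f (min x x')) < \<epsilon>"
      using \<delta>(2)[of 1 "\<lambda>_. min x x'" "\<lambda>_. max x x'"] x x' d
      by (auto simp: short_family_def disjoint_family_on_def dist_real_def max_def min_def)
    then show ?thesis
      by (cases "x \<le> x'") (auto simp: dist_norm max_def min_def norm_minus_commute)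
  qed
  then show "\<exists>d>0. \<forall>x'\<in>{a..b}. dist x' x < d \<longrightarrow> dist (f x') (f x) < \<epsilon>"
    using \<delta>(1) by blast
qed

lemma abs_continuous_on_interval_bounded:
  assumes "abs_continuous_on_interval a b f"
  obtains B where "B > 0" "\<And>r. r \<in> {a..b} \<Longrightarrow> norm (f r) \<le> B"
proof -
  have "bounded (f ` {a..b})"
    using abs_continuous_on_interval_imp_continuous_on[OF assms]
    by (intro compact_imp_bounded compact_continuous_image) auto
  then show ?thesis using that by (auto simp: bounded_pos)
qed

lemma lipschitz_on_imp_abs_continuous_on_interval:
  assumes "L-lipschitz_on {a..b} f"
  shows "abs_continuous_on_interval a b f"
proof (rule abs_continuous_on_intervalI)
  fix \<epsilon> :: real assume \<epsilon>: "\<epsilon> > 0"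
  have L: "L \<ge> 0" using assms by (rule lipschitz_on_nonneg)
  have "(\<Sum>i<n. norm (f (u i) - f (l i))) < \<epsilon>"
    \<comment> \<open>Dividing by \<open>L + 1\<close> instead of \<open>L\<close> covers the
      Lipschitz constant 0.\<close>
    if fam: "short_family a b (\<epsilon> / (L + 1)) n l u" for n l u
  proof -
    have "(\<Sum>i<n. norm (f (u i) - f (l i))) \<le> (\<Sum>i<n. (L + 1) * (u i - l i))"
    proof (rule sum_mono)
      fix i assume "i \<in> {..<n}"
      then have *: "a \<le> l i" "l i \<le> u i" "u i \<le> b" using short_family_bounds[OF fam] by auto
      have "norm (f (u i) - f (l i)) \<le> L * (u i - l i)"
        using lipschitz_onD[OF assms, of "u i" "l i"] * by (simp add: dist_norm)
      also have "\<dots> \<le> (L + 1) * (u i - l i)" using * by (intro mult_right_mono) auto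
      finally show "norm (f (u i) - f (l i)) \<le> (L + 1) * (u i - l i)" .
    qed
    also have "\<dots> = (L + 1) * (\<Sum>i<n. u i - l i)" by (simp only: sum_distrib_left)
    also have "\<dots> < \<epsilon>" using fam L by (simp add: short_family_def pos_less_divide_eq mult.commute)
    finally show ?thesis .
  qed
  then show "\<exists>\<delta>>0. \<forall>n l u. short_family a b \<delta> n l u \<longrightarrow> (\<Sum>i<n. norm (f (u i) - f (l i))) < \<epsilon>"
    using \<epsilon> L by (intro exI[of _ "\<epsilon> / (L + 1)"]) auto
qed

text \<open>A continuous derivative is bounded on the compact interval, and the mean value
  inequality turns that bound into a Lipschitz constant.\<close>

lemma C1_imp_abs_continuous_on_interval:
  fixes g g' :: "real \<Rightarrow> real"
  assumes "\<And>r. r \<in> {a..b} \<Longrightarrow> (g has_real_derivative g' r) (at r within {a..b})"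
    and "continuous_on {a..b} g'"
  shows "abs_continuous_on_interval a b g"
proof -
  have "bounded (g' ` {a..b})"
    using assms(2) by (intro compact_imp_bounded compact_continuous_image) auto
  then obtain B where B: "B > 0" "\<And>r. r \<in> {a..b} \<Longrightarrow> norm (g' r) \<le> B"
    by (auto simp: bounded_pos)
  have "B-lipschitz_on {a..b} g"
  proof (rule lipschitz_onI)
    fix x y assume "x \<in> {a..b}" "y \<in> {a..b}"
    then show "dist (g x) (g y) \<le> B * dist x y"
      using field_differentiable_bound[of "{a..b}" g g' B x y] assms(1) B by (auto simp: dist_norm)
  qed (use B in auto)
  then show ?thesis by (rule lipschitz_on_imp_abs_continuous_on_interval)
qed

text \<open>Both factors are bounded on the compact interval, so the increment of the product is
  controlled by the increments of the factors. It serves the first derivative of a transformed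
  trajectory, which is a scalar factor times a composed derivative.\<close>

lemma abs_continuous_on_interval_scaleR:
  fixes g :: "real \<Rightarrow> real" and f :: "real \<Rightarrow> 'a::real_normed_vector"
  assumes g: "abs_continuous_on_interval a b g" and f: "abs_continuous_on_interval a b f"
  shows "abs_continuous_on_interval a b (\<lambda>r. g r *\<^sub>R f r)"
proof (rule abs_continuous_on_intervalI)
  fix \<epsilon> :: real assume \<epsilon>: "\<epsilon> > 0"
  obtain B where B: "B > 0" "\<And>r. r \<in> {a..b} \<Longrightarrow> norm (f r) \<le> B"
    using abs_continuous_on_interval_bounded[OF f] by metis
  obtain M where M: "M > 0" "\<And>r. r \<in> {a..b} \<Longrightarrow> norm (g r) \<le> M"
    using abs_continuous_on_interval_bounded[OF g] by metis
  \<comment> \<open>The tolerances are crossed: increments of \<open>f\<close> get multiplied by the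
    bound \<open>M\<close> of \<open>g\<close>, those of \<open>g\<close> by the bound
    \<open>B\<close> of \<open>f\<close>, and each product contributes at most half of
    \<epsilon>.\<close>
  obtain \<delta>1 where \<delta>1: "\<delta>1 > 0"
    "\<And>n l u. short_family a b \<delta>1 n l u \<Longrightarrow> (\<Sum>i<n. norm (f (u i) - f (l i))) < \<epsilon> / (2 * M)"
    using f \<epsilon> M(1) unfolding abs_continuous_on_interval_iff
    by (metis divide_pos_pos mult_pos_pos zero_less_numeral)
  obtain \<delta>2 where \<delta>2: "\<delta>2 > 0"
    "\<And>n l u. short_family a b \<delta>2 n l u \<Longrightarrow> (\<Sum>i<n. norm (g (u i) - g (l i))) < \<epsilon> / (2 * B)"
    using g \<epsilon> B(1) unfolding abs_continuous_on_interval_iff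
    by (metis divide_pos_pos mult_pos_pos zero_less_numeral)
  have "(\<Sum>i<n. norm (g (u i) *\<^sub>R f (u i) - g (l i) *\<^sub>R f (l i))) < \<epsilon>"
    if fam: "short_family a b (min \<delta>1 \<delta>2) n l u" for n l u
  proof -
    have "(\<Sum>i<n. norm (g (u i) *\<^sub>R f (u i) - g (l i) *\<^sub>R f (l i)))
      \<le> (\<Sum>i<n. M * norm (f (u i) - f (l i)) + B * norm (g (u i) - g (l i)))"
    proof (rule sum_mono)
      fix i assume "i \<in> {..<n}"
      then have *: "a \<le> l i" "l i \<le> u i" "u i \<le> b" using short_family_bounds[OF fam] by auto
      have "g (u i) *\<^sub>R f (u i) - g (l i) *\<^sub>R f (l i)
          = g (u i) *\<^sub>R (f (u i) - f (l i)) + (g (u i) - g (l i)) *\<^sub>R f (l i)"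
        by (simp add: algebra_simps)
      then have "norm (g (u i) *\<^sub>R f (u i) - g (l i) *\<^sub>R f (l i))
        \<le> norm (g (u i)) * norm (f (u i) - f (l i)) + norm (f (l i)) * norm (g (u i) - g (l i))"
        by (metis norm_triangle_ineq norm_scaleR mult.commute real_norm_def)
      also have "\<dots> \<le> M * norm (f (u i) - f (l i)) + B * norm (g (u i) - g (l i))"
        using * B(2)[of "l i"] M(2)[of "u i"] by (intro add_mono mult_right_mono) auto
      finally show "norm (g (u i) *\<^sub>R f (u i) - g (l i) *\<^sub>R f (l i))
        \<le> M * norm (f (u i) - f (l i)) + B * norm (g (u i) - g (l i))" .
    qed
    also have "\<dots> = M * (\<Sum>i<n. norm (f (u i) - f (l i))) + B * (\<Sum>i<n. norm (g (u i) - g (l i)))"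
      by (simp add: sum.distrib sum_distrib_left)
    also have "\<dots> < M * (\<epsilon> / (2 * M)) + B * (\<epsilon> / (2 * B))"
      using B(1) M(1) short_family_mono[OF fam]
      by (intro add_strict_mono mult_strict_left_mono \<delta>1(2) \<delta>2(2)) auto
    also have "\<dots> = \<epsilon>" using B(1) M(1) by simp
    finally show ?thesis .
  qed
  then show "\<exists>\<delta>>0. \<forall>n l u. short_family a b \<delta> n l u \<longrightarrow>
        (\<Sum>i<n. norm (g (u i) *\<^sub>R f (u i) - g (l i) *\<^sub>R f (l i))) < \<epsilon>"
    using \<delta>1(1) \<delta>2(1) by (intro exI[of _ "min \<delta>1 \<delta>2"]) auto
qed

text \<open>Compositions of absolutely continuous functions can fail to be absolutely continuous. A
  monotone inner function, however, sends non-overlapping intervals to non-overlapping ones, and its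
  own absolute continuity makes the total length of the images small, so the image family is
  admissible for \<open>f\<close>.\<close>

lemma abs_continuous_on_interval_compose_mono:
  fixes \<phi> :: "real \<Rightarrow> real" and f :: "real \<Rightarrow> 'a::real_normed_vector"
  assumes \<phi>: "abs_continuous_on_interval a b \<phi>" and mono: "mono_on {a..b} \<phi>"
    and f: "abs_continuous_on_interval (\<phi> a) (\<phi> b) f"
  shows "abs_continuous_on_interval a b (\<lambda>r. f (\<phi> r))"
proof (rule abs_continuous_on_intervalI)
  fix \<epsilon> :: real assume \<epsilon>: "\<epsilon> > 0"
  obtain \<eta> where \<eta>: "\<eta> > 0"
    "\<And>n l u. short_family (\<phi> a) (\<phi> b) \<eta> n l u \<Longrightarrow> (\<Sum>i<n. norm (f (u i) - f (l i))) < \<epsilon>"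
    using f \<epsilon> unfolding abs_continuous_on_interval_iff by blast
  obtain \<delta> where \<delta>: "\<delta> > 0"
    "\<And>n l u. short_family a b \<delta> n l u \<Longrightarrow> (\<Sum>i<n. norm (\<phi> (u i) - \<phi> (l i))) < \<eta>"
    using \<phi> \<eta>(1) unfolding abs_continuous_on_interval_iff by blast
  have "(\<Sum>i<n. norm (f (\<phi> (u i)) - f (\<phi> (l i)))) < \<epsilon>"
    if fam: "short_family a b \<delta> n l u" for n l u
  proof -
    have \<phi>_le: "\<phi> x \<le> \<phi> y" if "a \<le> x" "x \<le> y" "y \<le> b" for x y
      using mono_onD[OF mono] that by auto
    have bounds: "\<phi> a \<le> \<phi> (l i) \<and> \<phi> (l i) \<le> \<phi> (u i) \<and> \<phi> (u i) \<le> \<phi> b" if "i < n" for i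
      using short_family_bounds[OF fam that] by (auto intro!: \<phi>_le)
    have "(\<Sum>i<n. \<phi> (u i) - \<phi> (l i)) \<le> (\<Sum>i<n. norm (\<phi> (u i) - \<phi> (l i)))"
      by (intro sum_mono) simp
    also have "\<dots> < \<eta>" using \<delta>(2)[OF fam] .
    finally have short: "(\<Sum>i<n. \<phi> (u i) - \<phi> (l i)) < \<eta>" .
    have "disjoint_family_on (\<lambda>i. {\<phi> (l i)<..<\<phi> (u i)}) {..<n}"
      unfolding disjoint_family_on_def
    proof (intro ballI impI)
      fix i j assume ij: "i \<in> {..<n}" "j \<in> {..<n}" "i \<noteq> j"
      then have bd: "a \<le> l i" "l i \<le> u i" "u i \<le> b" "a \<le> l j" "l j \<le> u j" "u j \<le> b"
        using short_family_bounds[OF fam] by auto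
      have e: "{l i<..<u i} \<inter> {l j<..<u j} = {}"
        using fam ij by (auto simp: short_family_def disjoint_family_on_def)
      have "\<not> max (l i) (l j) < min (u i) (u j)"
      proof
        assume "max (l i) (l j) < min (u i) (u j)"
        then obtain c where "max (l i) (l j) < c" "c < min (u i) (u j)" using dense by blast
        then have "c \<in> {l i<..<u i} \<inter> {l j<..<u j}" by auto
        then show False using e by auto
      qed
      \<comment> \<open>Two disjoint open intervals are ordered one after the other unless one is
        empty. A degenerate interval may sit inside another one, but its image is again
        degenerate.\<close>
      then have "l i = u i \<or> l j = u j \<or> u i \<le> l j \<or> u j \<le> l i" using bd by linarith
      then have "\<phi> (u i) \<le> \<phi> (l i) \<or> \<phi> (u j) \<le> \<phi> (l j) \<or> \<phi> (u i) \<le> \<phi> (l j) \<or> \<phi> (u j) \<le> \<phi> (l i)"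
        using \<phi>_le bd by (metis order.refl order.trans)
      then show "{\<phi> (l i)<..<\<phi> (u i)} \<inter> {\<phi> (l j)<..<\<phi> (u j)} = {}" by auto
    qed
    then show ?thesis
      using \<eta>(2)[of n "\<lambda>i. \<phi> (l i)" "\<lambda>i. \<phi> (u i)"] bounds short by (simp add: short_family_def)
  qed
  then show "\<exists>\<delta>>0. \<forall>n l u. short_family a b \<delta> n l u \<longrightarrow>
        (\<Sum>i<n. norm (f (\<phi> (u i)) - f (\<phi> (l i)))) < \<epsilon>"
    using \<delta>(1) by blast
qed

section \<open>Change of variables for null sets and one-sided derivatives\<close>

lemma AE_lebesgue_compose:
  fixes \<phi> \<psi> :: "real \<Rightarrow> real"
  assumes AE: "AE t in lebesgue. t \<in> T \<longrightarrow> P t"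
    and maps: "\<And>s. s \<in> S \<Longrightarrow> \<phi> s \<in> T" and inv: "\<And>s. s \<in> S \<Longrightarrow> \<psi> (\<phi> s) = s"
    and diff: "\<psi> differentiable_on T"
  shows "AE s in lebesgue. s \<in> S \<longrightarrow> P (\<phi> s)"
proof -
  obtain N where N: "{t \<in> space lebesgue. \<not> (t \<in> T \<longrightarrow> P t)} \<subseteq> N" "N \<in> null_sets lebesgue"
    using AE by (auto elim!: AE_E simp: null_sets_def)
  \<comment> \<open>The points where the composed property fails lie in the image under \<psi> of
    the exceptional set in \<open>T\<close>, and a differentiable map of the line sends negligible
    sets to negligible sets.\<close>
  have "negligible (N \<inter> T)"
    using N(2) negligible_subset[of N "N \<inter> T"] by (auto simp: negligible_iff_null_sets)
  then have "negligible (\<psi> ` (N \<inter> T))"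
    using differentiable_on_subset[OF diff, of "N \<inter> T"]
    by (intro negligible_differentiable_image_negligible) auto
  then have "\<psi> ` (N \<inter> T) \<in> null_sets lebesgue" by (simp add: negligible_iff_null_sets)
  moreover have "{s \<in> space lebesgue. \<not> (s \<in> S \<longrightarrow> P (\<phi> s))} \<subseteq> \<psi> ` (N \<inter> T)"
  proof
    fix s assume "s \<in> {s \<in> space lebesgue. \<not> (s \<in> S \<longrightarrow> P (\<phi> s))}"
    then have s: "s \<in> S" "\<not> P (\<phi> s)" by auto
    then have "\<phi> s \<in> N \<inter> T" using N(1) maps by auto
    then show "s \<in> \<psi> ` (N \<inter> T)" using inv[OF s(1)] by (metis image_eqI)
  qed
  ultimately show ?thesis by (rule AE_I')
qed

text \<open>Nontriviality of this filter makes derivatives within the half-line unique, including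
  the one-sided derivative at \<open>r0\<close>.\<close>

lemma at_within_atLeast_neq_bot: "r0 \<le> r \<Longrightarrow> at r within {r0..} \<noteq> bot" for r0 r :: real
proof -
  assume "r0 \<le> r"
  then have "at r within {r..r + 1} \<le> at r within {r0..}" by (intro at_le) auto
  moreover have "at r within {r..r + 1} \<noteq> bot" by (simp add: trivial_limit_within islimpt_Icc)
  ultimately show ?thesis by (metis bot.extremum_uniqueI)
qed

lemma deriv_from_eqI:
  assumes "(f has_vector_derivative f') (at r within {r0..})" "r0 \<le> r"
  shows "deriv_from r0 f r = f'"
  using vector_derivative_within[OF at_within_atLeast_neq_bot[OF assms(2)] assms(1)] .

lemma has_vector_derivative_compose_from:
  fixes \<phi> :: "real \<Rightarrow> real" and f :: "real \<Rightarrow> 'a::real_normed_vector"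
  assumes "(\<phi> has_real_derivative \<phi>') (at s within {a..})"
    and "\<And>r. r \<ge> a \<Longrightarrow> \<phi> r \<ge> b"
    and "diff_from b f (\<phi> s)"
  shows "((\<lambda>r. f (\<phi> r)) has_vector_derivative \<phi>' *\<^sub>R deriv_from b f (\<phi> s)) (at s within {a..})"
proof -
  \<comment> \<open>The chain rule asks for the derivative of \<open>f\<close> within the image of
    \<phi>. That image lies in \<open>{b..}\<close>, so the derivative within the half-line
    restricts to it.\<close>
  have "(f has_vector_derivative deriv_from b f (\<phi> s)) (at (\<phi> s) within \<phi> ` {a..})"
    using assms(2,3) by (intro has_vector_derivative_within_subset[of f _ _ "{b..}" "\<phi> ` {a..}"])
      (auto simp: vector_derivative_works[symmetric])
  moreover have "(\<phi> has_vector_derivative \<phi>') (at s within {a..})"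
    using assms(1) by (simp add: has_real_derivative_iff_has_vector_derivative)
  ultimately show ?thesis
    using vector_diff_chain_within[of \<phi> \<phi>' s "{a..}" f] by (simp add: o_def)
qed

section \<open>Smooth time changes between half-lines, covering \<tau> and \<sigma> at once\<close>

locale time_change =
  fixes a b :: real and \<phi> \<phi>' \<phi>'' \<psi> :: "real \<Rightarrow> real"
  assumes start: "\<phi> a = b" and mono: "mono_on {a..} \<phi>"
    and D1: "\<And>s. s \<ge> a \<Longrightarrow> (\<phi> has_real_derivative \<phi>' s) (at s within {a..})"
    and D2: "\<And>s. s \<ge> a \<Longrightarrow> (\<phi>' has_real_derivative \<phi>'' s) (at s within {a..})"
    and cont: "continuous_on {a..} \<phi>''"
    and inv: "\<And>s. s \<ge> a \<Longrightarrow> \<psi> (\<phi> s) = s" and diff_inv: "\<psi> differentiable_on {b..}"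
begin

lemma maps: "s \<ge> a \<Longrightarrow> \<phi> s \<ge> b"
  using mono_onD[OF mono, of a s] start by auto

text \<open>Both functions are continuously differentiable on the half-line: \<phi> because
  \<open>\<phi>'\<close> is differentiable and hence continuous, \<open>\<phi>'\<close> because
  \<open>\<phi>''\<close> is continuous.\<close>

lemma abs_continuous: "abs_continuous_on_interval a r \<phi>" "abs_continuous_on_interval a r \<phi>'"
proof -
  have "continuous_on {a..} \<phi>'"
    using D2 by (intro DERIV_continuous_on) auto
  then show "abs_continuous_on_interval a r \<phi>"
    by (intro C1_imp_abs_continuous_on_interval[of _ _ _ \<phi>'])
      (auto intro: DERIV_subset[OF D1] continuous_on_subset)
  show "abs_continuous_on_interval a r \<phi>'"
    using cont by (intro C1_imp_abs_continuous_on_interval[of _ _ _ \<phi>''])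
      (auto intro: DERIV_subset[OF D2] continuous_on_subset)
qed

lemma abs_continuous_compose:
  assumes "\<And>r1. r1 \<ge> b \<Longrightarrow> abs_continuous_on_interval b r1 f" "r \<ge> a"
  shows "abs_continuous_on_interval a r (\<lambda>s. f (\<phi> s))"
proof (rule abs_continuous_on_interval_compose_mono[OF abs_continuous(1)])
  show "mono_on {a..r} \<phi>" using mono by (rule mono_on_subset) auto
  \<comment> \<open>The hypothesis on \<open>f\<close> is used with right endpoint
    \<open>r1 = \<phi> r\<close>.\<close>
  show "abs_continuous_on_interval (\<phi> a) (\<phi> r) f" using assms maps start by simp
qed

text \<open>Here \<open>z\<close> is the given trajectory and \<open>w\<close> the time-changed one.
  Since \<open>w\<close> is prescribed only on \<open>{a..}\<close>, each fact is first shown for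
  the explicit composition and then carried over to \<open>w\<close> by agreement there.\<close>

context
  fixes V :: "'a::real_normed_vector \<Rightarrow> 'a" and z w :: "real \<Rightarrow> 'a"
  assumes reg: "solution_regularity V b z" and w: "\<And>s. s \<ge> a \<Longrightarrow> w s = z (\<phi> s)"
begin

lemma deriv_compose:
  assumes s: "s \<ge> a"
  shows "(w has_vector_derivative \<phi>' s *\<^sub>R deriv_from b z (\<phi> s)) (at s within {a..})"
proof -
  have "((\<lambda>r. z (\<phi> r)) has_vector_derivative \<phi>' s *\<^sub>R deriv_from b z (\<phi> s)) (at s within {a..})"
    using reg s maps D1 by (intro has_vector_derivative_compose_from) (auto simp: solution_regularity_def)
  then show ?thesis
    by (rule has_vector_derivative_transform[rotated 2]) (use s w in auto)
qed

lemma deriv_from_compose: "s \<ge> a \<Longrightarrow> deriv_from a w s = \<phi>' s *\<^sub>R deriv_from b z (\<phi> s)"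
  by (intro deriv_from_eqI deriv_compose)

lemma solution_regularity_compose: "solution_regularity V a w"
  unfolding solution_regularity_def
proof (intro conjI allI impI)
  fix r assume r: "a \<le> r"
  show "diff_from a w r"
    using deriv_compose[OF r] by (rule differentiableI_vector)
  have "abs_continuous_on_interval a r (\<lambda>s. z (\<phi> s))"
    using reg r by (intro abs_continuous_compose[of z]) (auto simp: solution_regularity_def)
  then show "abs_continuous_on_interval a r w"
    by (subst abs_continuous_on_interval_cong[of _ _ _ "\<lambda>s. z (\<phi> s)"]) (auto simp: w)
  \<comment> \<open>The chain rule for the first derivative holds at every point of the half-line,
    so the derivative of \<open>w\<close> equals this product everywhere on the interval.\<close>
  have "abs_continuous_on_interval a r (\<lambda>s. \<phi>' s *\<^sub>R deriv_from b z (\<phi> s))"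
    using reg r by (intro abs_continuous_on_interval_scaleR abs_continuous
        abs_continuous_compose[of "deriv_from b z"]) (auto simp: solution_regularity_def)
  then show "abs_continuous_on_interval a r (deriv_from a w)"
    by (subst abs_continuous_on_interval_cong) (auto simp: deriv_from_compose)
  have "abs_continuous_on_interval a r (\<lambda>s. V (z (\<phi> s)))"
    using reg r by (intro abs_continuous_compose[of "\<lambda>r. V (z r)"]) (auto simp: solution_regularity_def)
  then show "abs_continuous_on_interval a r (\<lambda>s. V (w s))"
    by (subst abs_continuous_on_interval_cong[of _ _ _ "\<lambda>s. V (z (\<phi> s))"]) (auto simp: w)
qed

text \<open>The operator itself is never differentiated: the chain rule is applied to
  \<open>V\<close> along \<open>z\<close> as a single function of time, at points where its
  derivative exists.\<close>

lemma deriv_V_compose: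
  assumes s: "s \<ge> a" and d: "diff_from b (\<lambda>r. V (z r)) (\<phi> s)"
  shows "diff_from a (\<lambda>r. V (w r)) s"
    and "deriv_from a (\<lambda>r. V (w r)) s = \<phi>' s *\<^sub>R deriv_from b (\<lambda>r. V (z r)) (\<phi> s)"
proof -
  have "((\<lambda>r. V (z (\<phi> r))) has_vector_derivative
      \<phi>' s *\<^sub>R deriv_from b (\<lambda>r. V (z r)) (\<phi> s)) (at s within {a..})"
    using has_vector_derivative_compose_from[OF D1[OF s] maps d] .
  then have "((\<lambda>r. V (w r)) has_vector_derivative
      \<phi>' s *\<^sub>R deriv_from b (\<lambda>r. V (z r)) (\<phi> s)) (at s within {a..})"
    by (rule has_vector_derivative_transform[rotated 2]) (use s w in auto)
  then show "diff_from a (\<lambda>r. V (w r)) s"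
    and "deriv_from a (\<lambda>r. V (w r)) s = \<phi>' s *\<^sub>R deriv_from b (\<lambda>r. V (z r)) (\<phi> s)"
    using s by (auto intro: differentiableI_vector deriv_from_eqI)
qed

text \<open>The product rule is applied to the formula for the first derivative of \<open>w\<close>.
  Differentiating the factor \<open>\<phi>'\<close> produces the extra term with
  \<open>\<phi>''\<close>, which later alters the damping coefficient.\<close>

lemma second_deriv_compose:
  assumes s: "s \<ge> a" and d: "diff_from b (deriv_from b z) (\<phi> s)"
  shows "diff_from a (deriv_from a w) s"
    and "deriv_from a (deriv_from a w) s
      = (\<phi>' s)\<^sup>2 *\<^sub>R deriv_from b (deriv_from b z) (\<phi> s) + \<phi>'' s *\<^sub>R deriv_from b z (\<phi> s)"
proof -
  let ?D = "\<phi>' s *\<^sub>R \<phi>' s *\<^sub>R deriv_from b (deriv_from b z) (\<phi> s) + \<phi>'' s *\<^sub>R deriv_from b z (\<phi> s)"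
  have "((\<lambda>r. \<phi>' r *\<^sub>R deriv_from b z (\<phi> r)) has_vector_derivative ?D) (at s within {a..})"
    using has_vector_derivative_scaleR[OF D2[OF s]
        has_vector_derivative_compose_from[OF D1[OF s] maps d]] .
  then have "(deriv_from a w has_vector_derivative ?D) (at s within {a..})"
    by (rule has_vector_derivative_transform[rotated 2]) (use s deriv_from_compose in auto)
  then show "diff_from a (deriv_from a w) s"
    and "deriv_from a (deriv_from a w) s
      = (\<phi>' s)\<^sup>2 *\<^sub>R deriv_from b (deriv_from b z) (\<phi> s) + \<phi>'' s *\<^sub>R deriv_from b z (\<phi> s)"
    using s deriv_from_eqI by (auto intro: differentiableI_vector simp: power2_eq_square)
qed

end

end

section \<open>Passage between (HB) and (AVD) by the two explicit time changes\<close>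

lemma HB_imp_AVD_solution:
  fixes V :: "'a::real_normed_vector \<Rightarrow> 'a"
  assumes \<alpha>: "\<alpha> > 0" and s0: "s0 > 0" and sol: "HB_solution V \<alpha> s0 t0 y0 y1 y"
    and x: "\<And>s. s \<ge> s0 \<Longrightarrow> x s = y (\<alpha> / 2 * ln (s / s0) + t0)"
  shows "AVD_solution V \<alpha> s0 y0 ((\<alpha> / (2 * s0)) *\<^sub>R y1) x"
proof -
  define \<tau> where "\<tau> s = \<alpha> / 2 * ln (s / s0) + t0" for s
  interpret time_change s0 t0 \<tau> "\<lambda>s. \<alpha> / (2 * s)" "\<lambda>s. - (\<alpha> / (2 * s\<^sup>2))"
    "\<lambda>t. s0 * exp (2 * (t - t0) / \<alpha>)"
  proof
    show "\<tau> s0 = t0" using s0 by (simp add: \<tau>_def)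
    show "mono_on {s0..} \<tau>"
      using \<alpha> s0 by (auto simp: \<tau>_def mono_on_def divide_right_mono)
    show "(\<tau> has_real_derivative \<alpha> / (2 * s)) (at s within {s0..})" if "s0 \<le> s" for s
      unfolding \<tau>_def using s0 that by (auto intro!: derivative_eq_intros simp: field_simps)
    show "((\<lambda>s. \<alpha> / (2 * s)) has_real_derivative - (\<alpha> / (2 * s\<^sup>2))) (at s within {s0..})"
      if "s0 \<le> s" for s
      using s0 that by (auto intro!: derivative_eq_intros simp: field_simps power2_eq_square)
    show "continuous_on {s0..} (\<lambda>s. - (\<alpha> / (2 * s\<^sup>2)))"
      using s0 by (auto intro!: continuous_intros)
    show "s0 * exp (2 * (\<tau> s - t0) / \<alpha>) = s" if "s0 \<le> s" for s
      using s0 \<alpha> that by (simp add: \<tau>_def)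
    show "(\<lambda>t. s0 * exp (2 * (t - t0) / \<alpha>)) differentiable_on {t0..}"
      using \<alpha> by (auto simp: differentiable_on_def real_differentiable_def
          intro!: exI derivative_eq_intros)
  qed
  have reg: "solution_regularity V t0 y" using sol by (simp add: HB_solution_def)
  have w: "\<And>s. s \<ge> s0 \<Longrightarrow> x s = y (\<tau> s)" using x by (simp add: \<tau>_def)
  let ?E = "\<lambda>t. diff_from t0 (deriv_from t0 y) t \<and> diff_from t0 (\<lambda>r. V (y r)) t \<and>
        deriv_from t0 (deriv_from t0 y) t
          + (2 * (\<alpha> - 1) / \<alpha>) *\<^sub>R deriv_from t0 y t
          + (2 * s0 / \<alpha> * exp (2 * (t - t0) / \<alpha>)) *\<^sub>R deriv_from t0 (\<lambda>r. V (y r)) t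
          + (2 * s0 / \<alpha> * exp (2 * (t - t0) / \<alpha>)) *\<^sub>R V (y t) = 0"
  have "AE t in lebesgue. t \<in> {t0..} \<longrightarrow> ?E t"
    using sol by (simp add: HB_solution_def)
  then have "AE s in lebesgue. s \<in> {s0..} \<longrightarrow> ?E (\<tau> s)"
    by (rule AE_lebesgue_compose[OF _ _ _ diff_inv]) (use maps inv in auto)
  then have AE: "AE s in lebesgue. s \<ge> s0 \<longrightarrow>
        diff_from s0 (deriv_from s0 x) s \<and> diff_from s0 (\<lambda>r. V (x r)) s \<and>
        deriv_from s0 (deriv_from s0 x) s
          + (\<alpha> / s) *\<^sub>R deriv_from s0 x s
          + deriv_from s0 (\<lambda>r. V (x r)) s
          + (\<alpha> / (2 * s)) *\<^sub>R V (x s) = 0"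
  proof (rule AE_mp, intro AE_I2 impI)
    fix s assume "s \<in> {s0..} \<longrightarrow> ?E (\<tau> s)" and s: "s \<ge> s0"
    then have E: "?E (\<tau> s)" by simp
    have "s > 0" using s s0 by simp
    \<comment> \<open>The exponential is the inverse time change evaluated at
      \<open>\<tau> s\<close>, so together with \<open>s0\<close> it collapses to
      \<open>s\<close>.\<close>
    have c: "2 * s0 / \<alpha> * exp (2 * (\<tau> s - t0) / \<alpha>) = 2 * s / \<alpha>"
      using inv[OF s] by (metis mult.assoc times_divide_eq_left)
    define A where "A = deriv_from t0 (deriv_from t0 y) (\<tau> s)"
    define B where "B = deriv_from t0 y (\<tau> s)"
    define C where "C = deriv_from t0 (\<lambda>r. V (y r)) (\<tau> s)"
    have "A + (2 * (\<alpha> - 1) / \<alpha>) *\<^sub>R B + (2 * s / \<alpha>) *\<^sub>R C + (2 * s / \<alpha>) *\<^sub>R V (y (\<tau> s)) = 0"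
      using E unfolding c A_def B_def C_def by blast
    then have "(\<alpha> / (2 * s))\<^sup>2 *\<^sub>R
        (A + (2 * (\<alpha> - 1) / \<alpha>) *\<^sub>R B + (2 * s / \<alpha>) *\<^sub>R C + (2 * s / \<alpha>) *\<^sub>R V (y (\<tau> s))) = 0"
      by simp
    \<comment> \<open>The damping coefficients match: both sides equal \<alpha> (\<alpha> - 1) / (2
      s^2), the right one being \<tau>'' + (\<alpha> / s) \<tau>'. The second identity says that
      \<tau>'^2 cancels against 2 s / \<alpha> to leave \<tau>'.\<close>
    moreover have "(\<alpha> / (2 * s))\<^sup>2 * (2 * (\<alpha> - 1) / \<alpha>) = - (\<alpha> / (2 * s\<^sup>2)) + \<alpha> / s * (\<alpha> / (2 * s))"
      "(\<alpha> / (2 * s))\<^sup>2 * (2 * s / \<alpha>) = \<alpha> / (2 * s)"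
      using \<alpha> \<open>s > 0\<close> by (simp_all add: field_simps power2_eq_square)
    ultimately have "(\<alpha> / (2 * s))\<^sup>2 *\<^sub>R A + (- (\<alpha> / (2 * s\<^sup>2)) + \<alpha> / s * (\<alpha> / (2 * s))) *\<^sub>R B
        + (\<alpha> / (2 * s)) *\<^sub>R C + (\<alpha> / (2 * s)) *\<^sub>R V (y (\<tau> s)) = 0"
      by (simp only: scaleR_add_right scaleR_scaleR)
    \<comment> \<open>Regrouped so that the bracket is the second derivative of \<open>x\<close>,
      the inner multiple of \<open>B\<close> its first derivative, and the multiple of
      \<open>C\<close> the derivative of \<open>V\<close> along \<open>x\<close>.\<close>
    then have "((\<alpha> / (2 * s))\<^sup>2 *\<^sub>R A + - (\<alpha> / (2 * s\<^sup>2)) *\<^sub>R B) + (\<alpha> / s) *\<^sub>R (\<alpha> / (2 * s)) *\<^sub>R B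
        + (\<alpha> / (2 * s)) *\<^sub>R C + (\<alpha> / (2 * s)) *\<^sub>R V (y (\<tau> s)) = 0"
      by (simp only: scaleR_add_left scaleR_scaleR add.assoc)
    then show "diff_from s0 (deriv_from s0 x) s \<and> diff_from s0 (\<lambda>r. V (x r)) s \<and>
        deriv_from s0 (deriv_from s0 x) s
          + (\<alpha> / s) *\<^sub>R deriv_from s0 x s
          + deriv_from s0 (\<lambda>r. V (x r)) s
          + (\<alpha> / (2 * s)) *\<^sub>R V (x s) = 0"
      using E second_deriv_compose[OF reg w s] deriv_V_compose[OF reg w s]
        deriv_from_compose[OF reg w s] w[OF s]
      unfolding A_def B_def C_def by simp
  qed
  show ?thesis
    unfolding AVD_solution_def
    \<comment> \<open>The initial velocity is the first-derivative formula at \<open>s0\<close>,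
      where \<tau>' equals \<alpha> / (2 s0) and \<open>\<tau> s0 = t0\<close>.\<close>
    using solution_regularity_compose[OF reg w] AE w[of s0] start deriv_from_compose[OF reg w, of s0] sol
    by (auto simp: HB_solution_def)
qed

text \<open>The mirror image of the previous argument: the equation at \<open>\<sigma> t\<close> is
  multiplied by \<sigma>'^2, where \<sigma>' = (2 / \<alpha>) \<sigma> and \<sigma>'' = (2 /
  \<alpha>)^2 \<sigma>.\<close>

lemma AVD_imp_HB_solution:
  fixes V :: "'a::real_normed_vector \<Rightarrow> 'a"
  assumes \<alpha>: "\<alpha> > 0" and s0: "s0 > 0" and sol: "AVD_solution V \<alpha> s0 x0 x1 x"
    and y: "\<And>t. t \<ge> t0 \<Longrightarrow> y t = x (s0 * exp (2 * (t - t0) / \<alpha>))"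
  shows "HB_solution V \<alpha> s0 t0 x0 ((2 * s0 / \<alpha>) *\<^sub>R x1) y"
proof -
  define \<sigma> where "\<sigma> t = s0 * exp (2 * (t - t0) / \<alpha>)" for t
  interpret time_change t0 s0 \<sigma> "\<lambda>t. 2 / \<alpha> * \<sigma> t" "\<lambda>t. (2 / \<alpha>)\<^sup>2 * \<sigma> t"
    "\<lambda>s. \<alpha> / 2 * ln (s / s0) + t0"
  proof
    show "\<sigma> t0 = s0" by (simp add: \<sigma>_def)
    show "mono_on {t0..} \<sigma>"
      using \<alpha> s0 by (auto simp: \<sigma>_def mono_on_def divide_right_mono)
    show "(\<sigma> has_real_derivative 2 / \<alpha> * \<sigma> t) (at t within {t0..})" for t
      unfolding \<sigma>_def using \<alpha> by (auto intro!: derivative_eq_intros simp: field_simps)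
    show "((\<lambda>t. 2 / \<alpha> * \<sigma> t) has_real_derivative (2 / \<alpha>)\<^sup>2 * \<sigma> t) (at t within {t0..})" for t
      unfolding \<sigma>_def using \<alpha>
      by (auto intro!: derivative_eq_intros simp: field_simps power2_eq_square)
    show "continuous_on {t0..} (\<lambda>t. (2 / \<alpha>)\<^sup>2 * \<sigma> t)"
      unfolding \<sigma>_def using \<alpha> by (auto intro!: continuous_intros)
    show "\<alpha> / 2 * ln (\<sigma> t / s0) + t0 = t" for t
      using s0 \<alpha> by (simp add: \<sigma>_def field_simps)
    show "(\<lambda>s. \<alpha> / 2 * ln (s / s0) + t0) differentiable_on {s0..}"
      unfolding differentiable_on_def real_differentiable_def
    proof
      fix s assume "s \<in> {s0..}"
      then have "((\<lambda>s. \<alpha> / 2 * ln (s / s0) + t0) has_real_derivative \<alpha> / (2 * s))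
          (at s within {s0..})"
        using s0 by (auto intro!: derivative_eq_intros simp: field_simps)
      then show "\<exists>D. ((\<lambda>s. \<alpha> / 2 * ln (s / s0) + t0) has_real_derivative D) (at s within {s0..})"
        by blast
    qed
  qed
  have reg: "solution_regularity V s0 x" using sol by (simp add: AVD_solution_def)
  have w: "\<And>t. t \<ge> t0 \<Longrightarrow> y t = x (\<sigma> t)" using y by (simp add: \<sigma>_def)
  let ?E = "\<lambda>s. diff_from s0 (deriv_from s0 x) s \<and> diff_from s0 (\<lambda>r. V (x r)) s \<and>
        deriv_from s0 (deriv_from s0 x) s
          + (\<alpha> / s) *\<^sub>R deriv_from s0 x s
          + deriv_from s0 (\<lambda>r. V (x r)) s
          + (\<alpha> / (2 * s)) *\<^sub>R V (x s) = 0"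
  have "AE s in lebesgue. s \<in> {s0..} \<longrightarrow> ?E s"
    using sol by (simp add: AVD_solution_def)
  then have "AE t in lebesgue. t \<in> {t0..} \<longrightarrow> ?E (\<sigma> t)"
    by (rule AE_lebesgue_compose[OF _ _ _ diff_inv]) (use maps inv in auto)
  then have AE: "AE t in lebesgue. t \<ge> t0 \<longrightarrow>
        diff_from t0 (deriv_from t0 y) t \<and> diff_from t0 (\<lambda>r. V (y r)) t \<and>
        deriv_from t0 (deriv_from t0 y) t
          + (2 * (\<alpha> - 1) / \<alpha>) *\<^sub>R deriv_from t0 y t
          + (2 * s0 / \<alpha> * exp (2 * (t - t0) / \<alpha>)) *\<^sub>R deriv_from t0 (\<lambda>r. V (y r)) t
          + (2 * s0 / \<alpha> * exp (2 * (t - t0) / \<alpha>)) *\<^sub>R V (y t) = 0"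
  proof (rule AE_mp, intro AE_I2 impI)
    fix t assume "t \<in> {t0..} \<longrightarrow> ?E (\<sigma> t)" and t: "t \<ge> t0"
    then have E: "?E (\<sigma> t)" by simp
    have pos: "\<sigma> t > 0" using s0 by (simp add: \<sigma>_def)
    have c: "2 * s0 / \<alpha> * exp (2 * (t - t0) / \<alpha>) = 2 / \<alpha> * \<sigma> t" by (simp add: \<sigma>_def)
    define A where "A = deriv_from s0 (deriv_from s0 x) (\<sigma> t)"
    define B where "B = deriv_from s0 x (\<sigma> t)"
    define C where "C = deriv_from s0 (\<lambda>r. V (x r)) (\<sigma> t)"
    have "A + (\<alpha> / \<sigma> t) *\<^sub>R B + C + (\<alpha> / (2 * \<sigma> t)) *\<^sub>R V (x (\<sigma> t)) = 0"
      using E unfolding A_def B_def C_def by blast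
    then have "(2 / \<alpha> * \<sigma> t)\<^sup>2 *\<^sub>R
        (A + (\<alpha> / \<sigma> t) *\<^sub>R B + C + (\<alpha> / (2 * \<sigma> t)) *\<^sub>R V (x (\<sigma> t))) = 0"
      by simp
    \<comment> \<open>Both sides of the first identity equal 4 \<sigma> / \<alpha>; its right side
      is \<sigma>'' plus the (HB) damping coefficient times \<sigma>'.\<close>
    moreover have "(2 / \<alpha> * \<sigma> t)\<^sup>2 * (\<alpha> / \<sigma> t)
          = (2 / \<alpha>)\<^sup>2 * \<sigma> t + 2 * (\<alpha> - 1) / \<alpha> * (2 / \<alpha> * \<sigma> t)"
      "(2 / \<alpha> * \<sigma> t)\<^sup>2 * (\<alpha> / (2 * \<sigma> t)) = 2 / \<alpha> * \<sigma> t"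
      using \<alpha> pos by (simp_all add: field_simps power2_eq_square)
    ultimately have "(2 / \<alpha> * \<sigma> t)\<^sup>2 *\<^sub>R A
        + ((2 / \<alpha>)\<^sup>2 * \<sigma> t + 2 * (\<alpha> - 1) / \<alpha> * (2 / \<alpha> * \<sigma> t)) *\<^sub>R B
        + (2 / \<alpha> * \<sigma> t)\<^sup>2 *\<^sub>R C + (2 / \<alpha> * \<sigma> t) *\<^sub>R V (x (\<sigma> t)) = 0"
      by (simp only: scaleR_add_right scaleR_scaleR)
    \<comment> \<open>The factor \<sigma>'^2 in front of \<open>C\<close> is split: one \<sigma>'
      belongs to the derivative of \<open>V\<close> along \<open>y\<close>, the other is the
      coefficient that (HB) places before it.\<close>
    then have "((2 / \<alpha> * \<sigma> t)\<^sup>2 *\<^sub>R A + ((2 / \<alpha>)\<^sup>2 * \<sigma> t) *\<^sub>R B)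
        + (2 * (\<alpha> - 1) / \<alpha>) *\<^sub>R (2 / \<alpha> * \<sigma> t) *\<^sub>R B
        + (2 / \<alpha> * \<sigma> t) *\<^sub>R (2 / \<alpha> * \<sigma> t) *\<^sub>R C + (2 / \<alpha> * \<sigma> t) *\<^sub>R V (x (\<sigma> t)) = 0"
      by (simp only: scaleR_add_left scaleR_scaleR add.assoc power2_eq_square)
    then show "diff_from t0 (deriv_from t0 y) t \<and> diff_from t0 (\<lambda>r. V (y r)) t \<and>
        deriv_from t0 (deriv_from t0 y) t
          + (2 * (\<alpha> - 1) / \<alpha>) *\<^sub>R deriv_from t0 y t
          + (2 * s0 / \<alpha> * exp (2 * (t - t0) / \<alpha>)) *\<^sub>R deriv_from t0 (\<lambda>r. V (y r)) t
          + (2 * s0 / \<alpha> * exp (2 * (t - t0) / \<alpha>)) *\<^sub>R V (y t) = 0"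
      using E second_deriv_compose[OF reg w t] deriv_V_compose[OF reg w t]
        deriv_from_compose[OF reg w t] w[OF t]
      unfolding c A_def B_def C_def by metis
  qed
  show ?thesis
    unfolding HB_solution_def
    using solution_regularity_compose[OF reg w] AE w[of t0] start deriv_from_compose[OF reg w, of t0] sol
    by (auto simp: AVD_solution_def)
qed

theorem proposition5p1:
  fixes V :: "'a::{real_inner, complete_space} \<Rightarrow> 'a"
    and \<alpha> s0 t0 :: real
    and y0 y1 x0 x1 :: 'a
  assumes "monotone_operator V"
    and "continuous_on UNIV V"
    and "\<alpha> > 2"
    and "s0 > 0"
    and "t0 \<ge> 0"
  shows "(\<forall>(y :: real \<Rightarrow> 'a) (\<tau> :: real \<Rightarrow> real) (x :: real \<Rightarrow> 'a).
            HB_solution V \<alpha> s0 t0 y0 y1 y \<and>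
            (\<forall>s\<ge>s0. \<tau> s = \<alpha> / 2 * ln (s / s0) + t0) \<and>
            (\<forall>s\<ge>s0. x s = y (\<tau> s)) \<longrightarrow>
              \<tau> ` {s0..} \<subseteq> {t0..} \<and>
              AVD_solution V \<alpha> s0 y0 ((\<alpha> / (2 * s0)) *\<^sub>R y1) x) \<and>
         (\<forall>(x :: real \<Rightarrow> 'a) (\<sigma> :: real \<Rightarrow> real) (y :: real \<Rightarrow> 'a).
            AVD_solution V \<alpha> s0 x0 x1 x \<and>
            (\<forall>t\<ge>t0. \<sigma> t = s0 * exp (2 * (t - t0) / \<alpha>)) \<and>
            (\<forall>t\<ge>t0. y t = x (\<sigma> t)) \<longrightarrow>
              \<sigma> ` {t0..} \<subseteq> {s0..} \<and>
              HB_solution V \<alpha> s0 t0 x0 ((2 * s0 / \<alpha>) *\<^sub>R x1) y)"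
proof (intro conjI allI impI; elim conjE)
  fix y x :: "real \<Rightarrow> 'a" and \<tau> :: "real \<Rightarrow> real"
  assume sol: "HB_solution V \<alpha> s0 t0 y0 y1 y"
    and \<tau>: "\<forall>s\<ge>s0. \<tau> s = \<alpha> / 2 * ln (s / s0) + t0" and x: "\<forall>s\<ge>s0. x s = y (\<tau> s)"
  show "\<tau> ` {s0..} \<subseteq> {t0..}" using \<tau> assms by auto
  show "AVD_solution V \<alpha> s0 y0 ((\<alpha> / (2 * s0)) *\<^sub>R y1) x"
    using assms \<tau> x by (intro HB_imp_AVD_solution[OF _ _ sol]) auto
next
  fix x y :: "real \<Rightarrow> 'a" and \<sigma> :: "real \<Rightarrow> real"
  assume sol: "AVD_solution V \<alpha> s0 x0 x1 x"
    and \<sigma>: "\<forall>t\<ge>t0. \<sigma> t = s0 * exp (2 * (t - t0) / \<alpha>)" and y: "\<forall>t\<ge>t0. y t = x (\<sigma> t)"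
  show "\<sigma> ` {t0..} \<subseteq> {s0..}" using \<sigma> assms by auto
  show "HB_solution V \<alpha> s0 t0 x0 ((2 * s0 / \<alpha>) *\<^sub>R x1) y"
    using assms \<sigma> y by (intro AVD_imp_HB_solution[OF _ _ sol]) auto
qed

end
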